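(* Let $D$ be an integral domain with quotient field $K$, let $B$ be an integral domain containing $D$, and let $E$ be a nonempty subset of $K$. If $E$ is infinite, then $\mathrm{Int}^{\mathrm R}_B(E,D)=\mathrm{Int}^{\mathrm R}(E,D)$. In particular, $\mathrm{Int}^{\mathrm R}_B(D)=\mathrm{Int}^{\mathrm R}(D)$.
   Context: For an extension of integral domains $D\subseteq B$, with $K$ the quotient field of $D$ regarded inside the quotient field $L$ of $B$, $B(X)$ denotes the set of all rational functions over $B$ (quotients $f/g$ with $f,g\in B[X]$, $g\neq 0$), and for a nonempty subset $E\subseteq K$, $$\mathrm{Int}^{\mathrm R}_B(E,D):=\{f\in B(X);\ f(E)\subseteq D\},$$ where $f(E)\subseteq D$ means that for every $e\in E$ the rational function $f$ is defined at $e$ and $f(e)\in D$. For $E=D$ one writes $\mathrm{Int}^{\mathrm R}_B(D):=\mathrm{Int}^{\mathrm R}_B(D,D)$. When $B=K$ the subscript is dropped: $\mathrm{Int}^{\mathrm R}(E,D):=\{f\in K(X);\ f(E)\subseteq D\}$ and $\mathrm{Int}^{\mathrm R}(D):=\mathrm{Int}^{\mathrm R}(D,D)$. All these are regarded as subrings of $L(X)$ (with $K(X)\subseteq L(X)$).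
   Formalization: The "in particular" claim is stated for infinite D only; for finite D it fails, e.g. D = F_q, B = F_q[t], f = t(X^q − X) lies in Int^R_B(D) but not in K(X). *)

theory Defs
  imports "HOL-Computational_Algebra.Computational_Algebra"
begin

text \<open>
  All integral domains live as subrings in one ambient field \<open>'l\<close>, the quotient field \<open>L\<close> of the
  largest one. The rational function field \<open>L(X)\<close> is the type \<open>'l poly fract\<close>.
\<close>

definition is_subring :: "'l::field set \<Rightarrow> bool" where
  "is_subring A \<longleftrightarrow> 1 \<in> A \<and> (\<forall>a\<in>A. \<forall>b\<in>A. a - b \<in> A \<and> a * b \<in> A)"

definition quotient_field :: "'l::field set \<Rightarrow> 'l set" where
  "quotient_field A = {a / b | a b. a \<in> A \<and> b \<in> A \<and> b \<noteq> 0}"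

definition rational_functions :: "'l::field set \<Rightarrow> 'l poly fract set" where
  "rational_functions A =
     {Fract p q | p q. set (coeffs p) \<subseteq> A \<and> set (coeffs q) \<subseteq> A \<and> q \<noteq> 0}"

text \<open>
  Being defined at \<open>e\<close> is a property of the rational function and not of a chosen representation:
  some representation has a denominator not vanishing at \<open>e\<close>.
\<close>

definition ratfun_defined_at :: "'l::field poly fract \<Rightarrow> 'l \<Rightarrow> bool" where
  "ratfun_defined_at f e \<longleftrightarrow> (\<exists>p q. f = Fract p q \<and> poly q e \<noteq> 0)"

definition ratfun_eval :: "'l::field poly fract \<Rightarrow> 'l \<Rightarrow> 'l" where
  "ratfun_eval f e = (THE v. \<exists>p q. f = Fract p q \<and> poly q e \<noteq> 0 \<and> v = poly p e / poly q e)"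

lemma ratfun_eval_Fract:
  assumes "poly q e \<noteq> 0"
  shows "ratfun_eval (Fract p q) e = poly p e / poly q e"
  unfolding ratfun_eval_def
proof (rule the_equality)
  show "\<exists>p' q'. Fract p q = Fract p' q' \<and> poly q' e \<noteq> 0 \<and> poly p e / poly q e = poly p' e / poly q' e"
    using assms by blast
next
  fix v
  assume "\<exists>p' q'. Fract p q = Fract p' q' \<and> poly q' e \<noteq> 0 \<and> v = poly p' e / poly q' e"
  then obtain p' q' where *: "Fract p q = Fract p' q'" "poly q' e \<noteq> 0" "v = poly p' e / poly q' e"
    by blast
  have "q \<noteq> 0" "q' \<noteq> 0"
    using assms *(2) by auto
  with *(1) have "p * q' = p' * q"
    by (simp add: eq_fract)
  then have "poly p e * poly q' e = poly p' e * poly q e"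
    by (metis poly_mult)
  then show "v = poly p e / poly q e"
    using assms * by (simp add: frac_eq_eq)
qed

definition IntR :: "'l::field set \<Rightarrow> 'l set \<Rightarrow> 'l set \<Rightarrow> 'l poly fract set" where
  "IntR B E D = {f \<in> rational_functions B. \<forall>e\<in>E. ratfun_defined_at f e \<and> ratfun_eval f e \<in> D}"

end

theory Submission
  imports Defs
begin

text \<open>
  Let \<open>K\<close> be the quotient field of \<open>D\<close> and \<open>L\<close> that of \<open>B\<close>. Clearing denominators shows that every
  rational function over \<open>L\<close> is one over \<open>B\<close> (\<open>rational_functions_eq_UNIV\<close>), so the inclusion
  from right to left is immediate. Conversely, a rational function over \<open>L\<close> with values in \<open>K\<close> at
  infinitely many points of \<open>K\<close> already lies in \<open>K(X)\<close>
  (\<open>rational_function_over_subfield\<close>). This is proved by expanding \<open>f = p/q\<close> as a continued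
  fraction, by induction on \<open>deg p + deg q\<close>: after replacing \<open>f\<close> by \<open>1/f\<close> if necessary,
  \<open>deg q \<le> deg p\<close>; for a point \<open>e\<close> with \<open>q(e) \<noteq> 0\<close> put \<open>c = f(e) \<in> K\<close> and write
  \<open>f = c + (X - e) g\<close>. Either \<open>g = 0\<close>, or \<open>g\<close> has denominator \<open>q\<close> and a numerator of degree less
  than \<open>deg p\<close>, and its values at the remaining points lie in \<open>K\<close>. The statement on \<open>D\<close> is the case \<open>E = D\<close>.
\<close>

section \<open>Subrings and polynomials with coefficients in a subring\<close>

lemma is_subring_closed:
  assumes "is_subring A"
  shows is_subring_one: "1 \<in> A"
    and is_subring_zero: "0 \<in> A"
    and is_subring_diff: "a \<in> A \<Longrightarrow> b \<in> A \<Longrightarrow> a - b \<in> A"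
    and is_subring_mult: "a \<in> A \<Longrightarrow> b \<in> A \<Longrightarrow> a * b \<in> A"
    and is_subring_uminus: "a \<in> A \<Longrightarrow> - a \<in> A"
    and is_subring_add: "a \<in> A \<Longrightarrow> b \<in> A \<Longrightarrow> a + b \<in> A"
proof -
  show one: "1 \<in> A" and diff: "\<And>a b. a \<in> A \<Longrightarrow> b \<in> A \<Longrightarrow> a - b \<in> A"
    and "a \<in> A \<Longrightarrow> b \<in> A \<Longrightarrow> a * b \<in> A"
    using assms by (auto simp: is_subring_def)
  show zero: "0 \<in> A"
    using diff[OF one one] by simp
  show uminus: "- a \<in> A" if "a \<in> A" for a
    using diff[OF zero that] by simp
  show "a + b \<in> A" if "a \<in> A" "b \<in> A"
    using diff[OF that(1) uminus[OF that(2)]] by simp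
qed

lemma is_subring_sum:
  assumes "is_subring A" "\<And>i. i \<in> I \<Longrightarrow> f i \<in> A"
  shows "sum f I \<in> A"
  using assms(2)
  by (induction I rule: infinite_finite_induct)
    (auto simp: is_subring_zero[OF assms(1)] intro: is_subring_add[OF assms(1)])

lemma set_coeffs_subset_iff:
  assumes "0 \<in> A"
  shows "set (coeffs p) \<subseteq> A \<longleftrightarrow> (\<forall>i. coeff p i \<in> A)"
proof -
  have "(\<forall>i. coeff p i \<in> A) \<longleftrightarrow> range (coeff p) \<subseteq> A"
    by auto
  then show ?thesis
    using assms by (simp add: range_coeff)
qed

lemma set_coeffs_pCons_subset:
  assumes "a \<in> A" "set (coeffs p) \<subseteq> A"
  shows "set (coeffs (pCons a p)) \<subseteq> A"
  using assms by (auto simp: cCons_def)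

lemma set_coeffs_add_subset:
  assumes "is_subring A" "set (coeffs p) \<subseteq> A" "set (coeffs q) \<subseteq> A"
  shows "set (coeffs (p + q)) \<subseteq> A"
  using assms(2,3) is_subring_add[OF assms(1)]
  by (simp add: set_coeffs_subset_iff[OF is_subring_zero[OF assms(1)]])

lemma set_coeffs_mult_subset:
  assumes "is_subring A" "set (coeffs p) \<subseteq> A" "set (coeffs q) \<subseteq> A"
  shows "set (coeffs (p * q)) \<subseteq> A"
  using assms(2,3) is_subring_mult[OF assms(1)]
  by (simp add: set_coeffs_subset_iff[OF is_subring_zero[OF assms(1)]] coeff_mult
      is_subring_sum[OF assms(1)])

lemma set_coeffs_smult_subset:
  assumes "is_subring A" "a \<in> A" "set (coeffs p) \<subseteq> A"
  shows "set (coeffs (smult a p)) \<subseteq> A"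
  using assms(2,3) is_subring_mult[OF assms(1)]
  by (simp add: set_coeffs_subset_iff[OF is_subring_zero[OF assms(1)]])

section \<open>Quotient fields and clearing denominators\<close>

lemma subset_quotient_field:
  assumes "is_subring A"
  shows "A \<subseteq> quotient_field A"
proof
  fix a assume "a \<in> A"
  then have "a = a / 1 \<and> a \<in> A \<and> 1 \<in> A \<and> (1::'a) \<noteq> 0"
    using is_subring_one[OF assms] by simp
  then show "a \<in> quotient_field A"
    unfolding quotient_field_def by blast
qed

lemma is_subring_quotient_field:
  assumes A: "is_subring A"
  shows "is_subring (quotient_field A)"
  unfolding is_subring_def
proof (intro conjI ballI)
  show "1 \<in> quotient_field A"
    using subset_quotient_field[OF A] is_subring_one[OF A] by blast
next
  fix x y assume "x \<in> quotient_field A" "y \<in> quotient_field A"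
  then obtain a b c d
    where xy: "x = a / b" "y = c / d" and mem: "a \<in> A" "b \<in> A" "c \<in> A" "d \<in> A"
      and nz: "b \<noteq> 0" "d \<noteq> 0"
    unfolding quotient_field_def by blast
  have "x - y = (a * d - c * b) / (b * d)" "a * d - c * b \<in> A"
    "x * y = (a * c) / (b * d)" "a * c \<in> A" "b * d \<in> A" "b * d \<noteq> 0"
    using xy nz mem by (auto simp: diff_frac_eq is_subring_closed[OF A])
  then show "x - y \<in> quotient_field A" "x * y \<in> quotient_field A"
    unfolding quotient_field_def by blast+
qed

lemma inverse_in_quotient_field:
  assumes "is_subring A" "x \<in> quotient_field A"
  shows "inverse x \<in> quotient_field A"
proof (cases "x = 0")
  case True
  then show ?thesis using assms(2) by simp
next
  case False
  obtain a b where "x = a / b" "a \<in> A" "b \<in> A" "b \<noteq> 0"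
    using assms(2) unfolding quotient_field_def by blast
  with False have "inverse x = b / a \<and> b \<in> A \<and> a \<in> A \<and> a \<noteq> 0"
    by auto
  then show ?thesis
    unfolding quotient_field_def by blast
qed

lemma clear_denominators:
  assumes B: "is_subring B" and "set (coeffs p) \<subseteq> quotient_field B"
  shows "\<exists>b\<in>B. b \<noteq> 0 \<and> set (coeffs (smult b p)) \<subseteq> B"
  using assms(2)
proof (induction p)
  case 0
  show ?case
    using is_subring_one[OF B] by (intro bexI[of _ 1]) auto
next
  case (pCons a p)
  have "a \<in> quotient_field B" "set (coeffs p) \<subseteq> quotient_field B"
    using pCons.hyps pCons.prems by (auto simp: cCons_def split: if_splits)
  then obtain x y b where a: "a = x / y" "x \<in> B" "y \<in> B" "y \<noteq> 0"
    and b: "b \<in> B" "b \<noteq> 0" "set (coeffs (smult b p)) \<subseteq> B"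
    using pCons.IH unfolding quotient_field_def by blast
  have "smult (b * y) (pCons a p) = pCons (b * x) (smult y (smult b p))"
    using a by (simp add: mult.commute)
  moreover have "set (coeffs (smult y (smult b p))) \<subseteq> B"
    by (rule set_coeffs_smult_subset[OF B a(3) b(3)])
  ultimately have "set (coeffs (smult (b * y) (pCons a p))) \<subseteq> B"
    using set_coeffs_pCons_subset[OF is_subring_mult[OF B b(1) a(2)]] by metis
  then show ?case
    using a b is_subring_mult[OF B] by (intro bexI[of _ "b * y"]) auto
qed

lemma rational_functions_eq_UNIV:
  assumes B: "is_subring B" and "quotient_field B = UNIV"
  shows "rational_functions B = UNIV"
proof (intro equalityI subsetI UNIV_I)
  fix f :: "'a poly fract"
  obtain p q where f: "f = Fract p q" "q \<noteq> 0"
    by (cases f) auto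
  obtain b where b: "b \<in> B" "b \<noteq> 0" "set (coeffs (smult b p)) \<subseteq> B"
    using clear_denominators[OF B, of p] assms(2) by auto
  obtain c where c: "c \<in> B" "c \<noteq> 0" "set (coeffs (smult c q)) \<subseteq> B"
    using clear_denominators[OF B, of q] assms(2) by auto
  have "set (coeffs (smult c (smult b p))) \<subseteq> B" "set (coeffs (smult b (smult c q))) \<subseteq> B"
    using b c set_coeffs_smult_subset[OF B] by blast+
  moreover have "f = Fract (smult c (smult b p)) (smult b (smult c q))"
    "smult b (smult c q) \<noteq> 0"
    using f b c by (auto simp: eq_fract mult.commute)
  ultimately show "f \<in> rational_functions B"
    unfolding rational_functions_def by blast
qed

section \<open>Rational functions with values in a subfield\<close>

text \<open>
  The conclusion says that \<open>p/q = p'/q'\<close> with \<open>p', q' \<in> K[X]\<close>. Since \<open>x / 0 = 0\<close> lies in \<open>K\<close>, the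
  assumption on values carries no information at the zeros of \<open>q\<close> and is stable under exchanging
  \<open>p\<close> and \<open>q\<close>.
\<close>
lemma rational_function_over_subfield:
  fixes p q :: "'l::field poly"
  assumes K: "is_subring K" and inv: "\<And>x. x \<in> K \<Longrightarrow> inverse x \<in> K"
    and "q \<noteq> 0" "infinite E" "E \<subseteq> K" "\<And>e. e \<in> E \<Longrightarrow> poly p e / poly q e \<in> K"
  shows "\<exists>p' q'. set (coeffs p') \<subseteq> K \<and> set (coeffs q') \<subseteq> K \<and> q' \<noteq> 0 \<and> p * q' = p' * q"
  using assms(3-)
proof (induction "degree p + degree q" arbitrary: p q E rule: less_induct)
  case less
  note one = is_subring_one[OF K] and zero = is_subring_zero[OF K]
  \<comment> \<open>The step for \<open>deg t \<le> deg s\<close>; it is used below for \<open>s/t\<close> equal to \<open>p/q\<close> or to \<open>q/p\<close>.\<close>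
  have step: "\<exists>p' q'. set (coeffs p') \<subseteq> K \<and> set (coeffs q') \<subseteq> K \<and> q' \<noteq> 0 \<and> s * q' = p' * t"
    if deg: "degree s + degree t = degree p + degree q" "degree t \<le> degree s"
      and "t \<noteq> 0" and vals: "\<And>e. e \<in> E \<Longrightarrow> poly s e / poly t e \<in> K" for s t
  proof -
    have "\<not> E \<subseteq> {x. poly t x = 0}"
      using poly_roots_finite[OF \<open>t \<noteq> 0\<close>] \<open>infinite E\<close> finite_subset by blast
    then obtain e where e: "e \<in> E" "poly t e \<noteq> 0"
      by blast
    define c where "c = poly s e / poly t e"
    have c: "c \<in> K" and eK: "e \<in> K"
      using vals e \<open>E \<subseteq> K\<close> by (auto simp: c_def)
    have "poly (s - smult c t) e = 0"
      using e by (simp add: c_def)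
    then obtain r where r: "s - smult c t = [:- e, 1:] * r"
      unfolding poly_eq_0_iff_dvd by (rule dvdE)
    then have s: "s = smult c t + [:- e, 1:] * r"
      by (simp add: algebra_simps)
    show ?thesis
    proof (cases "r = 0")
      case True
      then have "s * 1 = [:c:] * t"
        using s by simp
      moreover have "set (coeffs [:c:]) \<subseteq> K" "set (coeffs (1 :: 'l poly)) \<subseteq> K" "(1 :: 'l poly) \<noteq> 0"
        using set_coeffs_pCons_subset[of c K 0] c one by auto
      ultimately show ?thesis
        by blast
    next
      case False
      have "degree ([:- e, 1:] * r) = Suc (degree r)"
        using False by (subst degree_mult_eq) auto
      moreover have "degree (s - smult c t) \<le> degree s"
        using deg(2) degree_smult_le[of c t] by (intro degree_diff_le) auto
      ultimately have "degree r + degree t < degree p + degree q"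
        using r deg(1) by simp
      moreover have "poly r x / poly t x \<in> K" if x: "x \<in> E - {e}" for x
      proof (cases "poly t x = 0")
        case True
        then show ?thesis using zero by simp
      next
        case False
        have "poly s x / poly t x - c = (x - e) * (poly r x / poly t x)"
          using False by (subst s) (simp add: field_simps)
        then have "poly r x / poly t x = (poly s x / poly t x - c) * inverse (x - e)"
          using x by (simp add: divide_inverse mult.commute mult.left_commute)
        moreover have "poly s x / poly t x - c \<in> K" "inverse (x - e) \<in> K"
          using x vals c eK \<open>E \<subseteq> K\<close> by (auto intro!: inv is_subring_diff[OF K])
        ultimately show ?thesis
          using is_subring_mult[OF K] by simp
      qed
      moreover have "infinite (E - {e})" "E - {e} \<subseteq> K"
        using \<open>infinite E\<close> \<open>E \<subseteq> K\<close> by auto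
      ultimately obtain r' q' where r': "set (coeffs r') \<subseteq> K" "set (coeffs q') \<subseteq> K" "q' \<noteq> 0"
        "r * q' = r' * t"
        using less.hyps[of r t "E - {e}"] \<open>t \<noteq> 0\<close> by blast
      have "s * q' = smult c q' * t + [:- e, 1:] * (r * q')"
        by (subst s) (simp add: algebra_simps)
      then have "s * q' = (smult c q' + [:- e, 1:] * r') * t"
        unfolding r'(4) by (simp add: algebra_simps)
      moreover have "set (coeffs [:- e, 1:]) \<subseteq> K"
        using is_subring_uminus[OF K eK] one by (intro set_coeffs_pCons_subset) auto
      then have "set (coeffs (smult c q' + [:- e, 1:] * r')) \<subseteq> K"
        using c r' by (intro set_coeffs_add_subset set_coeffs_mult_subset set_coeffs_smult_subset K)
      ultimately show ?thesis
        using r' by blast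
    qed
  qed
  show ?case
  proof (cases "degree q \<le> degree p")
    case True
    then show ?thesis
      using step[of p q] less.prems by blast
  next
    case False
    show ?thesis
    proof (cases "p = 0")
      case True
      then show ?thesis
        using one by (intro exI[of _ 0] exI[of _ 1]) auto
    next
      case p: False
      have "poly q e / poly p e \<in> K" if "e \<in> E" for e
        using inv[OF less.prems(4)[OF that]] by simp
      then obtain p' q' where *: "set (coeffs p') \<subseteq> K" "set (coeffs q') \<subseteq> K" "q' \<noteq> 0"
        "q * q' = p' * p"
        using step[of q p] False p by auto
      then have "p' \<noteq> 0"
        using \<open>q \<noteq> 0\<close> by auto
      moreover have "p * p' = q' * q"
        using * by (simp add: mult.commute)
      ultimately show ?thesis
        using * by blast
    qed
  qed
qed

lemma IntR_eq_IntR_quotient_field: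
  fixes D B E :: "'l::field set"
  assumes D: "is_subring D" and B: "is_subring B" "quotient_field B = UNIV"
    and E: "E \<subseteq> quotient_field D" "infinite E"
  shows "IntR B E D = IntR (quotient_field D) E D"
proof -
  let ?K = "quotient_field D"
  have K: "is_subring ?K"
    by (rule is_subring_quotient_field[OF D])
  have "f \<in> rational_functions ?K" if f: "\<forall>e\<in>E. ratfun_eval f e \<in> D" for f
  proof -
    obtain p q where pq: "f = Fract p q" "q \<noteq> 0"
      by (cases f) auto
    have "poly p e / poly q e \<in> ?K" if "e \<in> E" for e
    proof (cases "poly q e = 0")
      case True
      then show ?thesis using is_subring_zero[OF K] by simp
    next
      case False
      then show ?thesis
        using f that subset_quotient_field[OF D] ratfun_eval_Fract[OF False, of p] pq(1) by auto
    qed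
    then obtain p' q' where *: "set (coeffs p') \<subseteq> ?K" "set (coeffs q') \<subseteq> ?K" "q' \<noteq> 0"
      "p * q' = p' * q"
      using rational_function_over_subfield[OF K inverse_in_quotient_field[OF D] pq(2) E(2,1)]
      by blast
    then have "f = Fract p' q'"
      using pq by (simp add: eq_fract)
    with * show ?thesis
      unfolding rational_functions_def by blast
  qed
  then show ?thesis
    unfolding IntR_def rational_functions_eq_UNIV[OF B] by blast
qed

theorem proposition1p5:
  fixes D B E :: "'l::field set"
  assumes "is_subring D" and "is_subring B" and "D \<subseteq> B"
    and "quotient_field B = UNIV"
    and "E \<subseteq> quotient_field D" and "E \<noteq> {}"
  shows "(infinite E \<longrightarrow> IntR B E D = IntR (quotient_field D) E D) \<and>
         (infinite D \<longrightarrow> IntR B D D = IntR (quotient_field D) D D)"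
  using IntR_eq_IntR_quotient_field[OF assms(1,2,4) assms(5)]
    IntR_eq_IntR_quotient_field[OF assms(1,2,4) subset_quotient_field[OF assms(1)]]
  by simp

end
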